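(* Let $x\ge 1$ be a real number. (i) The power series $[x]_q\in\mathbb Z[[q]]$ converges in the disk $|q|<3-2\sqrt2$. (ii) The holomorphic function defined by $[x]_q$ analytically continues to a non-vanishing holomorphic function on the region $D$.
   Context: For an integer $n\ge 0$ put $[n]_q=\frac{1-q^n}{1-q}$. Every real $x\ge1$ has a unique expansion as an infinite negative continued fraction $x=[[c_1,c_2,\ldots]]:=c_1-\frac{1}{c_2-\frac{1}{c_3-\cdots}}$ with integers $c_j\ge2$ (rational $x$ correspond to sequences that are eventually equal to $2$). For $N\ge1$ set $$[x]_{N,q}:=[c_1]_q-\frac{q^{c_1-1}}{[c_2]_q-\cdots\frac{q^{c_{N-1}-1}}{[c_N]_q}}.$$ These rational functions, expanded at $q=0$, converge $q$-adically as $N\to\infty$, and $[x]_q\in\mathbb Z[[q]]$ denotes their limit (the $q$-real number of Morier-Genoud and Ovsienko). $D\subset\mathbb C$ is the open region containing $0$ whose boundary is given in polar coordinates $q=re^{i\theta}$ by $r=1+2\sin\frac\theta2-2\sqrt{\sin\frac\theta2\,(1+\sin\frac\theta2)}$, $0\le\theta\le2\pi$; i.e. $D$ is the set of $re^{i\theta}$, $0\le \theta\le 2\pi$, with $0\le r<1+2\sin\frac\theta2-2\sqrt{\sin\frac\theta2\,(1+\sin\frac\theta2)}$. *)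

theory Defs
  imports "HOL-Complex_Analysis.Complex_Analysis"
begin

section \<open>Negative continued fractions\<close>

text \<open>
  A list \<open>[c\<^sub>1, \<dots>, c\<^sub>N]\<close> with \<open>N \<ge> 1\<close> represents a finite continued fraction; the value at the empty
  list is irrelevant. Infinite expansions \<open>(c\<^sub>1, c\<^sub>2, \<dots>)\<close> are functions on \<^typ>\<open>nat\<close> and are
  indexed from \<open>0\<close>, so that \<open>c j\<close> stands for \<open>c\<^bsub>j+1\<^esub>\<close>.
\<close>

fun neg_cf :: "nat list \<Rightarrow> real" where
  "neg_cf [] = 0"
| "neg_cf [c] = real c"
| "neg_cf (c # d # cs) = real c - 1 / neg_cf (d # cs)"

definition is_neg_cf_expansion :: "(nat \<Rightarrow> nat) \<Rightarrow> real \<Rightarrow> bool" where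
  "is_neg_cf_expansion c x \<longleftrightarrow>
     (\<forall>j. c j \<ge> 2) \<and> (\<lambda>N. neg_cf (map c [0..<N])) \<longlonglongrightarrow> x"

definition neg_cf_expansion :: "real \<Rightarrow> nat \<Rightarrow> nat" where
  "neg_cf_expansion x = (THE c. is_neg_cf_expansion c x)"


section \<open>The q-deformation\<close>

text \<open>
  The rational functions \<open>[x]\<^bsub>N,q\<^esub>\<close> are expanded at \<open>q = 0\<close> from the start, i.e. computed in the ring of
  formal power series. All divisions are by series with constant coefficient \<open>1\<close>, see
  \<open>q_cf_nth_0\<close> below.
\<close>

definition q_int :: "nat \<Rightarrow> complex fps" where
  "q_int n = (1 - fps_X ^ n) / (1 - fps_X)"

fun q_cf :: "nat list \<Rightarrow> complex fps" where
  "q_cf [] = 0"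
| "q_cf [c] = q_int c"
| "q_cf (c # d # cs) = q_int c - fps_X ^ (c - 1) / q_cf (d # cs)"

definition q_trunc :: "real \<Rightarrow> nat \<Rightarrow> complex fps" where
  "q_trunc x N = q_cf (map (neg_cf_expansion x) [0..<N])"

definition complex_fps :: "int fps \<Rightarrow> complex fps" where
  "complex_fps F = Abs_fps (\<lambda>n. of_int (fps_nth F n))"

text \<open>The limit is taken in the metric of \<^typ>\<open>complex fps\<close>, which is the q-adic one.\<close>

definition q_real :: "real \<Rightarrow> int fps" where
  "q_real x = (THE F. q_trunc x \<longlonglongrightarrow> complex_fps F)"


section \<open>The region\<close>

definition q_region :: "complex set" where
  "q_region = {rcis r \<theta> | r \<theta>. 0 \<le> \<theta> \<and> \<theta> \<le> 2 * pi \<and> 0 \<le> r \<and>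
     r < 1 + 2 * sin (\<theta> / 2) - 2 * sqrt (sin (\<theta> / 2) * (1 + sin (\<theta> / 2)))}"


section \<open>Existence and uniqueness of the expansion\<close>

lemma neg_cf_Suc:
  "neg_cf (map c [0..<Suc (Suc n)]) = real (c 0) - 1 / neg_cf (map (\<lambda>i. c (Suc i)) [0..<Suc n])"
  by (simp add: map_upt_Suc del: upt_Suc)

lemma neg_cf_bounds:
  assumes "\<And>j. c j \<ge> 2"
  shows "1 \<le> neg_cf (map c [0..<Suc n]) \<and> neg_cf (map c [0..<Suc n]) \<le> real (c 0)"
  using assms
proof (induction n arbitrary: c)
  case 0
  have "2 \<le> c 0" by (fact 0)
  then show ?case by simp
next
  case (Suc n)
  define v where "v = neg_cf (map (\<lambda>i. c (Suc i)) [0..<Suc n])"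
  have "1 \<le> v"
    using Suc.IH[of "\<lambda>i. c (Suc i)"] Suc.prems unfolding v_def by blast
  then have "0 \<le> 1 / v" "1 / v \<le> 1" by simp_all
  moreover have "2 \<le> real (c 0)" using Suc.prems[of 0] by simp
  ultimately show ?case
    unfolding neg_cf_Suc v_def[symmetric] by linarith
qed

lemma neg_cf_error:
  assumes "\<And>j. c j \<ge> 2" "\<And>j. t j \<ge> 1" "\<And>j. t j = real (c j) - 1 / t (Suc j)"
  shows "0 \<le> neg_cf (map c [0..<Suc n]) - t 0 \<and> neg_cf (map c [0..<Suc n]) - t 0 \<le> 1 / real (Suc n)"
  using assms
proof (induction n arbitrary: c t)
  case 0
  have "t 1 \<ge> 1" "t 0 = real (c 0) - 1 / t 1"
    using "0"(2)[of 1] "0"(3)[of 0] by auto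
  then show ?case by simp
next
  case (Suc n)
  define v where "v = neg_cf (map (\<lambda>i. c (Suc i)) [0..<Suc n])"
  define d where "d = v - t 1"
  have d: "0 \<le> d" "d \<le> 1 / real (Suc n)"
    using Suc.IH[of "\<lambda>i. c (Suc i)" "\<lambda>i. t (Suc i)", OF Suc.prems]
    unfolding d_def v_def One_nat_def by blast+
  have t: "t 1 \<ge> 1" "t 0 = real (c 0) - 1 / t 1"
    using Suc.prems(2)[of 1] Suc.prems(3)[of 0] by auto
  have "neg_cf (map c [0..<Suc (Suc n)]) - t 0 = 1 / t 1 - 1 / (t 1 + d)"
    unfolding neg_cf_Suc v_def[symmetric] using t by (simp add: d_def)
  also have eq: "\<dots> = d / (t 1 * (t 1 + d))"
    using t d by (simp add: field_simps)
  finally have eq: "neg_cf (map c [0..<Suc (Suc n)]) - t 0 = d / (t 1 * (t 1 + d))" .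
  have "1 * (1 + d) \<le> t 1 * (t 1 + d)"
    using t d by (intro mult_mono) auto
  then have "d / (t 1 * (t 1 + d)) \<le> d / (1 + d)"
    using d by (intro divide_left_mono) auto
  also have "\<dots> \<le> 1 / real (Suc (Suc n))"
    using d by (simp add: field_simps)
  finally show ?case unfolding eq using t d by simp
qed

lemma neg_cf_expansion_exists:
  assumes "x \<ge> 1"
  shows "\<exists>c. is_neg_cf_expansion c x"
proof -
  define a where "a = (\<lambda>t::real. nat (\<lfloor>t\<rfloor> + 1))"
  define t where "t = (\<lambda>j. ((\<lambda>t. 1 / (real (a t) - t)) ^^ j) x)"
  define c where "c = (\<lambda>j. a (t j))"
  have a: "a y \<ge> 2" "real (a y) - y > 0" "real (a y) - y \<le> 1" if "y \<ge> 1" for y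
  proof -
    have "\<lfloor>y\<rfloor> \<ge> 1" using that by linarith
    then show "a y \<ge> 2" "real (a y) - y > 0" "real (a y) - y \<le> 1"
      unfolding a_def by (linarith)+
  qed
  have t1: "t j \<ge> 1" for j
  proof (induction j)
    case (Suc j)
    then show ?case using a(2,3)[OF Suc] by (simp add: t_def)
  qed (use assms in \<open>simp add: t_def\<close>)
  have c2: "c j \<ge> 2" for j
    using a(1)[OF t1] by (simp add: c_def)
  have rec: "t j = real (c j) - 1 / t (Suc j)" for j
    using a(2)[OF t1[of j]] by (simp add: t_def c_def)
  have err: "0 \<le> neg_cf (map c [0..<Suc N]) - t 0 \<and> neg_cf (map c [0..<Suc N]) - t 0 \<le> 1 / real (Suc N)" for N
    by (rule neg_cf_error) (fact c2 t1 rec)+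
  have "(\<lambda>N. neg_cf (map c [0..<Suc N]) - t 0) \<longlonglongrightarrow> 0"
  proof (rule tendsto_sandwich[where f = "\<lambda>_. 0" and h = "\<lambda>N. 1 / real (Suc N)"])
    show "(\<lambda>N. 1 / real (Suc N)) \<longlonglongrightarrow> 0"
      using LIMSEQ_inverse_real_of_nat by (simp add: inverse_eq_divide)
  qed (intro always_eventually allI conjunct1[OF err] conjunct2[OF err] tendsto_const)+
  then have "(\<lambda>N. neg_cf (map c [0..<Suc N])) \<longlonglongrightarrow> x"
    by (subst (asm) LIM_zero_iff) (simp add: t_def)
  then have "(\<lambda>N. neg_cf (map c [0..<N])) \<longlonglongrightarrow> x"
    by (rule LIMSEQ_imp_Suc)
  with c2 show ?thesis by (auto simp: is_neg_cf_expansion_def)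
qed

lemma is_neg_cf_expansion_step:
  assumes "is_neg_cf_expansion c x"
  shows "int (c 0) = \<lfloor>x\<rfloor> + 1"
    and "is_neg_cf_expansion (\<lambda>j. c (Suc j)) (1 / (real (c 0) - x))"
proof -
  define v where "v = (\<lambda>N. neg_cf (map (\<lambda>i. c (Suc i)) [0..<Suc N]))"
  define w where "w = (\<lambda>N. real (c 0) - neg_cf (map c [0..<Suc (Suc N)]))"
  have c2: "c j \<ge> 2" for j
    using assms by (simp add: is_neg_cf_expansion_def)
  have lim: "(\<lambda>N. neg_cf (map c [0..<N])) \<longlonglongrightarrow> x"
    using assms by (auto simp: is_neg_cf_expansion_def)
  have v: "1 \<le> v N" "v N \<le> real (c 1)" for N
    using neg_cf_bounds[of "\<lambda>i. c (Suc i)" N] c2 by (auto simp: v_def)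
  have w: "w N = 1 / v N" for N
    unfolding w_def v_def neg_cf_Suc by simp
  have c1: "real (c 1) > 0" using c2[of 1] by simp
  have wb: "1 / real (c 1) \<le> w N" "w N \<le> 1" for N
    using v[of N] c1 by (auto simp: w field_simps)
  have "(\<lambda>N. neg_cf (map c [0..<Suc (Suc N)])) \<longlonglongrightarrow> x"
    using LIMSEQ_Suc[OF LIMSEQ_Suc[OF lim]] .
  then have limw: "w \<longlonglongrightarrow> real (c 0) - x"
    unfolding w_def by (intro tendsto_intros)
  have "1 / real (c 1) \<le> real (c 0) - x"
    using wb by (intro LIMSEQ_le_const[OF limw]) blast
  moreover have "0 < 1 / real (c 1)" using c1 by simp
  ultimately have b: "0 < real (c 0) - x" by linarith
  have b2: "real (c 0) - x \<le> 1"
    using wb by (intro LIMSEQ_le_const2[OF limw]) blast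
  from b b2 show "int (c 0) = \<lfloor>x\<rfloor> + 1" by linarith
  have "(\<lambda>N. 1 / w N) \<longlonglongrightarrow> 1 / (real (c 0) - x)"
    using limw b by (intro tendsto_intros) auto
  then have "v \<longlonglongrightarrow> 1 / (real (c 0) - x)" by (simp add: w)
  then have "(\<lambda>N. neg_cf (map (\<lambda>i. c (Suc i)) [0..<N])) \<longlonglongrightarrow> 1 / (real (c 0) - x)"
    unfolding v_def by (rule LIMSEQ_imp_Suc)
  with c2 show "is_neg_cf_expansion (\<lambda>j. c (Suc j)) (1 / (real (c 0) - x))"
    by (auto simp: is_neg_cf_expansion_def)
qed

lemma neg_cf_expansion_unique:
  assumes "is_neg_cf_expansion c x" "is_neg_cf_expansion d x"
  shows "c = d"
proof
  show "c j = d j" for j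
    using assms
  proof (induction j arbitrary: c d x)
    case 0
    then show ?case using is_neg_cf_expansion_step(1)[of c x] is_neg_cf_expansion_step(1)[of d x] by simp
  next
    case (Suc j)
    have "c 0 = d 0"
      using is_neg_cf_expansion_step(1)[of c x] is_neg_cf_expansion_step(1)[of d x] Suc.prems by simp
    then show ?case
      using Suc.IH is_neg_cf_expansion_step(2)[OF Suc.prems(1)]
        is_neg_cf_expansion_step(2)[OF Suc.prems(2)] by simp
  qed
qed

lemma is_neg_cf_expansion_neg_cf_expansion:
  assumes "x \<ge> 1"
  shows "is_neg_cf_expansion (neg_cf_expansion x) x"
proof -
  obtain c where c: "is_neg_cf_expansion c x"
    using neg_cf_expansion_exists[OF assms] by blast
  show ?thesis
    unfolding neg_cf_expansion_def using c
    by (rule theI[where P = "\<lambda>c. is_neg_cf_expansion c x"]) (rule neg_cf_expansion_unique[OF _ c])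
qed


section \<open>Existence, integrality and uniqueness of the q-adic limit\<close>

lemma complex_fps_nth [simp]: "fps_nth (complex_fps F) n = of_int (fps_nth F n)"
  by (simp add: complex_fps_def)

lemma complex_fps_inject [simp]: "complex_fps F = complex_fps G \<longleftrightarrow> F = G"
  by (simp add: fps_eq_iff)

lemma complex_fps_hom:
  "complex_fps 1 = 1" "complex_fps fps_X = fps_X"
  "complex_fps (F - G) = complex_fps F - complex_fps G"
  "complex_fps (F * G) = complex_fps F * complex_fps G"
  by (simp_all add: fps_eq_iff fps_mult_nth)

lemma complex_fps_power: "complex_fps (F ^ n) = complex_fps F ^ n"
  by (induction n) (simp_all add: complex_fps_hom)

lemma complex_fps_inverse:
  assumes "fps_nth (complex_fps F) 0 = 1"
  shows "\<exists>G. inverse (complex_fps F) = complex_fps G"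
proof -
  have "F * fps_right_inverse F 1 = 1"
    by (rule fps_right_inverse) (use assms in simp)
  then have "complex_fps F * complex_fps (fps_right_inverse F 1) = 1"
    by (metis complex_fps_hom(1,4))
  then have "inverse (complex_fps F) = complex_fps (fps_right_inverse F 1)"
    by (rule fps_inverse_unique)
  then show ?thesis by blast
qed

lemma q_int_nth_0: "c \<ge> 1 \<Longrightarrow> fps_nth (q_int c) 0 = 1"
  by (simp add: q_int_def)

lemma q_int_integral: "\<exists>F. q_int c = complex_fps F"
proof -
  obtain G where "inverse (complex_fps (1 - fps_X)) = complex_fps G"
    using complex_fps_inverse[of "1 - fps_X"] by auto
  then have "q_int c = complex_fps ((1 - fps_X ^ c) * G)"
    by (simp add: q_int_def fps_divide_unit complex_fps_hom complex_fps_power)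
  then show ?thesis by blast
qed

lemma q_cf_nth_0:
  assumes "cs \<noteq> []" "\<forall>c\<in>set cs. c \<ge> 2"
  shows "fps_nth (q_cf cs) 0 = 1"
  using assms
proof (induction cs rule: q_cf.induct)
  case (3 c d cs)
  then have "fps_nth (q_cf (d # cs)) 0 = 1" by auto
  then show ?case using 3 by (simp add: q_int_nth_0)
qed (auto simp: q_int_nth_0)

lemma q_cf_integral:
  assumes "\<forall>c\<in>set cs. c \<ge> 2"
  shows "\<exists>F. q_cf cs = complex_fps F"
  using assms
proof (induction cs rule: q_cf.induct)
  case 1
  have "q_cf [] = complex_fps 0" by (simp add: fps_eq_iff)
  then show ?case by blast
next
  case (2 c)
  then show ?case using q_int_integral by simp
next
  case (3 c d cs)
  have nz: "fps_nth (q_cf (d # cs)) 0 = 1"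
    using 3 by (intro q_cf_nth_0) auto
  obtain F where F: "q_cf (d # cs) = complex_fps F" using 3 by auto
  obtain G where G: "inverse (q_cf (d # cs)) = complex_fps G"
    using complex_fps_inverse[of F] F nz by auto
  obtain H where H: "q_int c = complex_fps H" using q_int_integral by blast
  have "q_cf (c # d # cs) = complex_fps (H - fps_X ^ (c - 1) * G)"
    using nz by (simp add: fps_divide_unit G H complex_fps_hom complex_fps_power)
  then show ?case by blast
qed

lemma q_cf_Suc:
  "q_cf (map c [0..<Suc (Suc n)]) = q_int (c 0) - fps_X ^ (c 0 - 1) / q_cf (map (\<lambda>i. c (Suc i)) [0..<Suc n])"
  by (simp add: map_upt_Suc del: upt_Suc)

lemma q_cf_diff:
  assumes "\<And>j. c j \<ge> 2"
  shows "\<exists>G. q_cf (map c [0..<Suc (Suc n)]) - q_cf (map c [0..<Suc n]) = fps_X ^ Suc n * G"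
  using assms
proof (induction n arbitrary: c)
  case 0
  have "q_cf (map c [0..<Suc (Suc 0)]) - q_cf (map c [0..<Suc 0])
      = - (fps_X ^ (c 0 - 1) / q_int (c 1))"
    by simp
  also have "\<dots> = fps_X ^ (c 0 - 1) * - inverse (q_int (c 1))"
    using "0"[of 1] by (simp add: fps_divide_unit q_int_nth_0)
  also have "c 0 - 1 = 1 + (c 0 - 2)" using "0"[of 0] by simp
  also have "fps_X ^ (1 + (c 0 - 2)) * - inverse (q_int (c 1)) =
    fps_X ^ Suc 0 * (fps_X ^ (c 0 - 2) * - inverse (q_int (c 1)))"
    by (simp add: mult.assoc)
  finally show ?case by blast
next
  case (Suc n)
  define A where "A = q_cf (map (\<lambda>i. c (Suc i)) [0..<Suc (Suc n)])"
  define B where "B = q_cf (map (\<lambda>i. c (Suc i)) [0..<Suc n])"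
  obtain G where G: "A - B = fps_X ^ Suc n * G"
    using Suc.IH[of "\<lambda>i. c (Suc i)"] Suc.prems unfolding A_def B_def by blast
  have nz: "fps_nth A 0 = 1" "fps_nth B 0 = 1"
    unfolding A_def B_def using Suc.prems by (intro q_cf_nth_0; auto)+
  have inv: "A * inverse A = 1" "B * inverse B = 1"
    using nz by (auto intro: inverse_mult_eq_1')
  define m where "m = c 0 - 2"
  have "c 0 \<ge> 2" by (rule Suc.prems)
  then have m: "c 0 - 1 = Suc m" by (simp add: m_def)
  have "q_cf (map c [0..<Suc (Suc (Suc n))]) - q_cf (map c [0..<Suc (Suc n)])
      = fps_X ^ Suc m * inverse B - fps_X ^ Suc m * inverse A"
    unfolding q_cf_Suc[of c "Suc n"] q_cf_Suc[of c n] A_def[symmetric] B_def[symmetric] m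
    using nz by (simp add: fps_divide_unit)
  also have "\<dots> = fps_X ^ Suc m * ((A * inverse A) * inverse B - (B * inverse B) * inverse A)"
    unfolding inv by (simp only: right_diff_distrib mult_1_left)
  also have "\<dots> = fps_X ^ Suc m * ((A - B) * (inverse A * inverse B))"
    by (subst left_diff_distrib) (simp only: mult.assoc mult.commute mult.left_commute)
  also have "\<dots> = fps_X ^ Suc (Suc n) * (fps_X ^ m * (G * inverse A * inverse B))"
    unfolding G power_Suc by (simp only: mult.assoc mult.commute mult.left_commute)
  finally show ?case by blast
qed

lemma q_cf_stable:
  assumes "\<And>j. c j \<ge> 2" "N \<ge> Suc k"
  shows "fps_nth (q_cf (map c [0..<N])) k = fps_nth (q_cf (map c [0..<Suc k])) k"
  using assms(2)
proof (induction N rule: dec_induct)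
  case (step N)
  then obtain n where n: "N = Suc n" "k \<le> n" by (cases N) auto
  obtain G where "q_cf (map c [0..<Suc N]) - q_cf (map c [0..<N]) = fps_X ^ N * G"
    using q_cf_diff[of c n] assms(1) unfolding n by blast
  then have "fps_nth (q_cf (map c [0..<Suc N]) - q_cf (map c [0..<N])) k = 0"
    using n by (simp only: fps_X_power_mult_nth) simp
  then show ?case using step.IH by simp
qed simp

lemma q_trunc_tendsto:
  assumes "x \<ge> 1"
  shows "q_trunc x \<longlonglongrightarrow> complex_fps (q_real x)"
proof -
  define c where "c = neg_cf_expansion x"
  have c2: "c j \<ge> 2" for j
    using is_neg_cf_expansion_neg_cf_expansion[OF assms] by (simp add: c_def is_neg_cf_expansion_def)
  have "\<exists>m::int. fps_nth (q_cf (map c [0..<Suc k])) k = of_int m" for k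
    using q_cf_integral[of "map c [0..<Suc k]"] c2 by fastforce
  then obtain f where f: "fps_nth (q_cf (map c [0..<Suc k])) k = of_int (f k :: int)" for k
    by metis
  have ex: "q_trunc x \<longlonglongrightarrow> complex_fps (Abs_fps f)"
  proof (rule tendsto_fpsI)
    fix k
    show "eventually (\<lambda>N. fps_nth (q_trunc x N) k = fps_nth (complex_fps (Abs_fps f)) k) sequentially"
      using eventually_ge_at_top[of "Suc k"]
    proof eventually_elim
      case (elim N)
      then show ?case
        using q_cf_stable[of c, OF c2 elim] f[of k] by (simp add: q_trunc_def c_def)
    qed
  qed
  then show ?thesis
    unfolding q_real_def
  proof (rule theI[where P = "\<lambda>F. q_trunc x \<longlonglongrightarrow> complex_fps F"])
    fix F assume "q_trunc x \<longlonglongrightarrow> complex_fps F"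
    then have "complex_fps F = complex_fps (Abs_fps f)"
      using ex by (rule LIMSEQ_unique)
    then show "F = Abs_fps f" by simp
  qed
qed

end

theory Submission
  imports Defs
begin

text \<open>
  A convergent of \<open>[x]\<^bsub>q\<^esub>\<close> is built by composing the Moebius maps
  \<open>w \<mapsto> [c]\<^bsub>q\<^esub> - q\<^bsup>c-1\<^esup> / w\<close> with \<open>c \<ge> 2\<close>. The idea is to find, for each \<open>q\<close> in the region, one disc
  that all these maps send into itself and that does not contain the pole \<open>0\<close>. In the coordinate
  \<open>(1 - q) w\<close> discs centred at \<open>1\<close> are convenient: \<open>(1 - q) [c]\<^bsub>q\<^esub> - 1 = -q\<^bsup>c\<^esup>\<close> is small, and
  with \<open>r = \<bar>q\<bar>\<close> the disc of radius \<open>\<epsilon> < 1\<close> is preserved as soon as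
  \<open>r\<^sup>2 + r \<bar>1 - q\<bar>\<^sup>2 / (1 - \<epsilon>) \<le> \<epsilon>\<close>, that is, \<open>r \<bar>1 - q\<bar>\<^sup>2 \<le> (\<epsilon> - r\<^sup>2) (1 - \<epsilon>)\<close>. The right-hand side
  is largest for \<open>\<epsilon> = (1 + r\<^sup>2) / 2\<close>, which leaves the condition \<open>4 r \<bar>1 - q\<bar>\<^sup>2 \<le> (1 - r\<^sup>2)\<^sup>2\<close>.
  Since \<open>\<bar>1 - q\<bar>\<^sup>2 = (1 - r)\<^sup>2 + 4 r sin\<^sup>2 (\<theta>/2)\<close>, the strict form of this condition is exactly
  \<open>(1 - r)\<^sup>2 > 4 r sin (\<theta>/2)\<close> when \<open>r < 1\<close>, and solving that quadratic inequality for \<open>r\<close> gives the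
  polar description of the region (\<open>q_region_subset_invariant_disc_region\<close>).

  The convergents are therefore holomorphic on the region, locally bounded, and stay in a closed
  disc that avoids \<open>0\<close> (\<open>q_cf_value_in_disc\<close>). By Montel's theorem a subsequence converges
  locally uniformly; the limit still takes its values in these discs, so it has no zeros. Its Taylor
  series at \<open>0\<close> is the q-adic limit of those of the convergents, that is, \<open>[x]\<^bsub>q\<^esub>\<close>. A disc
  centred at \<open>0\<close> on which the limit is holomorphic is a disc of convergence of that series.
\<close>

section \<open>The region where an invariant disc exists\<close>

definition invariant_disc_region :: "complex set" where
  "invariant_disc_region =
     {q. norm q < 1 \<and> 4 * norm q * (norm (1 - q))\<^sup>2 < (1 - (norm q)\<^sup>2)\<^sup>2}"

lemma open_invariant_disc_region: "open invariant_disc_region"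
  unfolding invariant_disc_region_def
  by (intro open_Collect_conj open_Collect_less continuous_intros)

lemma cmod_one_minus_rcis:
  "(norm (1 - rcis r \<theta>))\<^sup>2 = (1 - r)\<^sup>2 + 4 * r * (sin (\<theta> / 2))\<^sup>2"
proof -
  have "(norm (1 - rcis r \<theta>))\<^sup>2 = (1 - r * cos \<theta>)\<^sup>2 + (r * sin \<theta>)\<^sup>2"
    by (simp add: cmod_power2)
  also have "\<dots> = 1 - 2 * r * cos \<theta> + r\<^sup>2 * ((sin \<theta>)\<^sup>2 + (cos \<theta>)\<^sup>2)"
    by algebra
  also have "\<dots> = 1 - 2 * r * cos \<theta> + r\<^sup>2"
    by simp
  also have "cos \<theta> = 1 - 2 * (sin (\<theta> / 2))\<^sup>2"
    using cos_double_sin[of "\<theta> / 2"] by simp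
  finally show ?thesis
    by (simp add: power2_eq_square algebra_simps)
qed

text \<open>
  The bound on \<open>r\<close> is the smaller root of \<open>(1 - r)\<^sup>2 - 4 r s\<close>. The product of the two roots is \<open>1\<close>,
  so the smaller one is at most \<open>1\<close> and the quadratic is positive to its left.
\<close>

lemma less_smaller_root:
  fixes r s :: real
  assumes "0 \<le> s" and r: "r < 1 + 2 * s - 2 * sqrt (s * (1 + s))"
  shows "r < 1" "4 * r * s < (1 - r)\<^sup>2"
proof -
  define d where "d = sqrt (s * (1 + s))"
  have d: "d \<ge> 0" "d\<^sup>2 = s * (1 + s)"
    using assms(1) by (simp_all add: d_def)
  have "s\<^sup>2 \<le> d\<^sup>2"
    using assms(1) d(2) by (simp add: power2_eq_square algebra_simps)
  then have "s \<le> d"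
    using d(1) by (rule power2_le_imp_le)
  with r show "r < 1"
    by (simp add: d_def)
  have "0 < (1 + 2 * s - 2 * d - r) * (1 + 2 * s + 2 * d - r)"
    using r d(1) unfolding d_def[symmetric] by (intro mult_pos_pos) linarith+
  also have "\<dots> = (1 + 2 * s - r)\<^sup>2 - 4 * d\<^sup>2"
    by (simp add: power2_eq_square algebra_simps)
  also have "\<dots> = (1 - r)\<^sup>2 - 4 * r * s"
    unfolding d(2) by (simp add: power2_eq_square algebra_simps)
  finally show "4 * r * s < (1 - r)\<^sup>2"
    by simp
qed

text \<open>
  By \<open>cmod_one_minus_rcis\<close> and \<open>1 - r\<^sup>2 = (1 - r) (1 + r)\<close>, the inequality to be shown reads
  \<open>16 r\<^sup>2 s\<^sup>2 < (1 - r)\<^sup>4\<close> with \<open>s = sin (\<theta>/2)\<close>, the square of the inequality that defines the region.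
\<close>

lemma q_region_subset_invariant_disc_region: "q_region \<subseteq> invariant_disc_region"
proof
  fix q assume "q \<in> q_region"
  then obtain r \<theta> where q: "q = rcis r \<theta>" and \<theta>: "0 \<le> \<theta>" "\<theta> \<le> 2 * pi" and "0 \<le> r"
    and r: "r < 1 + 2 * sin (\<theta> / 2) - 2 * sqrt (sin (\<theta> / 2) * (1 + sin (\<theta> / 2)))"
    unfolding q_region_def by blast
  define s where "s = sin (\<theta> / 2)"
  have s: "0 \<le> s"
    using \<theta> by (auto simp: s_def intro: sin_ge_zero)
  have root: "r < 1" "4 * r * s < (1 - r)\<^sup>2"
    using less_smaller_root[OF s] r by (auto simp: s_def)
  have "(4 * r * s)\<^sup>2 < ((1 - r)\<^sup>2)\<^sup>2"
    using root(2) s \<open>0 \<le> r\<close> by (intro power_strict_mono) auto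
  moreover have "(1 - r\<^sup>2)\<^sup>2 - 4 * r * ((1 - r)\<^sup>2 + 4 * r * s\<^sup>2) = ((1 - r)\<^sup>2)\<^sup>2 - (4 * r * s)\<^sup>2"
    by (simp add: power2_eq_square algebra_simps)
  ultimately have "4 * r * ((1 - r)\<^sup>2 + 4 * r * s\<^sup>2) < (1 - r\<^sup>2)\<^sup>2"
    by linarith
  then show "q \<in> invariant_disc_region"
    using root(1) \<open>0 \<le> r\<close> cmod_one_minus_rcis[of r \<theta>]
    by (simp add: invariant_disc_region_def q s_def)
qed

text \<open>The worst direction is the negative axis, where \<open>\<bar>1 - q\<bar> = 1 + \<bar>q\<bar>\<close>.\<close>

lemma ball_subset_invariant_disc_region: "ball 0 (3 - 2 * sqrt 2) \<subseteq> invariant_disc_region"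
proof
  fix q :: complex assume "q \<in> ball 0 (3 - 2 * sqrt 2)"
  define r where "r = norm q"
  have "0 \<le> r" and r: "r < 3 - 2 * sqrt 2"
    using \<open>q \<in> _\<close> by (simp_all add: r_def)
  have root: "r < 1" "4 * r < (1 - r)\<^sup>2"
    using less_smaller_root[of 1 r] r by simp_all
  have "norm (1 - q) \<le> 1 + r"
    using norm_triangle_ineq4[of 1 q] by (simp add: r_def)
  then have "4 * r * (norm (1 - q))\<^sup>2 \<le> 4 * r * (1 + r)\<^sup>2"
    using \<open>0 \<le> r\<close> by (intro mult_left_mono power_mono) auto
  also have "\<dots> < (1 - r)\<^sup>2 * (1 + r)\<^sup>2"
    using root(2) \<open>0 \<le> r\<close> by (intro mult_strict_right_mono) auto
  also have "\<dots> = (1 - r\<^sup>2)\<^sup>2"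
    by (simp add: power2_eq_square algebra_simps)
  finally show "q \<in> invariant_disc_region"
    using root(1) by (simp add: invariant_disc_region_def r_def)
qed


section \<open>The convergents as functions\<close>

fun q_cf_value :: "nat list \<Rightarrow> complex \<Rightarrow> complex" where
  "q_cf_value [] q = 0"
| "q_cf_value [c] q = (1 - q ^ c) / (1 - q)"
| "q_cf_value (c # d # cs) q = (1 - q ^ c) / (1 - q) - q ^ (c - 1) / q_cf_value (d # cs) q"

lemma q_cf_value_has_fps_expansion:
  assumes "\<forall>c\<in>set cs. c \<ge> 2"
  shows "q_cf_value cs has_fps_expansion q_cf cs"
proof -
  have q_int: "(\<lambda>q. (1 - q ^ c) / (1 - q)) has_fps_expansion q_int c" for c
    unfolding q_int_def by (intro fps_expansion_intros) auto
  show ?thesis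
    using assms
  proof (induction cs rule: q_cf.induct)
    case 1
    then show ?case by (simp add: has_fps_expansion_0)
  next
    case (2 c)
    then show ?case using q_int by simp
  next
    case (3 c d cs)
    have "fps_nth (q_cf (d # cs)) 0 = 1"
      using 3 by (intro q_cf_nth_0) auto
    then have "(\<lambda>q. (1 - q ^ c) / (1 - q) - q ^ (c - 1) / q_cf_value (d # cs) q)
                 has_fps_expansion q_cf (c # d # cs)"
      unfolding q_cf.simps using 3
      by (intro has_fps_expansion_diff q_int has_fps_expansion_divide'
            has_fps_expansion_fps_X_power) auto
    then show ?case by simp
  qed
qed

definition in_invariant_disc :: "complex \<Rightarrow> complex \<Rightarrow> bool" where
  "in_invariant_disc q w \<longleftrightarrow> norm ((1 - q) * w - 1) \<le> (1 + (norm q)\<^sup>2) / 2"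

lemma in_invariant_disc_bounds:
  assumes "norm q < 1" "in_invariant_disc q w"
  shows "(1 - (norm q)\<^sup>2) / 2 \<le> norm ((1 - q) * w)" "norm ((1 - q) * w) \<le> 2" "w \<noteq> 0"
proof -
  define z where "z = (1 - q) * w"
  have r: "(norm q)\<^sup>2 < 1"
    using assms(1) by (simp add: abs_square_less_1)
  have z: "norm (z - 1) \<le> (1 + (norm q)\<^sup>2) / 2"
    using assms(2) by (simp add: in_invariant_disc_def z_def)
  have "1 - norm (z - 1) \<le> norm z"
    using norm_triangle_ineq4[of z "z - 1"] by simp
  with z show *: "(1 - (norm q)\<^sup>2) / 2 \<le> norm ((1 - q) * w)"
    unfolding z_def[symmetric] by (simp add: field_simps)
  have "norm z \<le> norm (z - 1) + 1"
    using norm_triangle_ineq[of "z - 1" 1] by simp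
  with z r show "norm ((1 - q) * w) \<le> 2"
    unfolding z_def[symmetric] by (simp add: field_simps)
  show "w \<noteq> 0"
    using * r by auto
qed

lemma q_int_in_invariant_disc:
  assumes "norm q < 1" "c \<ge> 2"
  shows "in_invariant_disc q ((1 - q ^ c) / (1 - q))"
proof -
  have "q \<noteq> 1" using assms(1) by auto
  then have "norm ((1 - q) * ((1 - q ^ c) / (1 - q)) - 1) = norm q ^ c"
    by (simp add: norm_power)
  also have "\<dots> \<le> (norm q)\<^sup>2"
    using assms by (intro power_decreasing) auto
  also have "\<dots> \<le> (1 + (norm q)\<^sup>2) / 2"
    using assms(1) by (simp add: power_le_one)
  finally show ?thesis
    by (simp add: in_invariant_disc_def)
qed

text \<open>
  In the coordinate \<open>z = (1 - q) w\<close> the map sends \<open>z - 1\<close> to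
  \<open>-q\<^bsup>c-2\<^esup> (q\<^sup>2 + q (1 - q)\<^sup>2 / z)\<close>, and \<open>\<bar>z\<bar> \<ge> \<eta> = (1 - \<bar>q\<bar>\<^sup>2) / 2\<close> on the disc. The condition on \<open>q\<close> is
  \<open>\<bar>q\<bar> \<bar>1 - q\<bar>\<^sup>2 < \<eta>\<^sup>2\<close>, so the image has modulus at most \<open>\<bar>q\<bar>\<^sup>2 + \<eta>\<close>, the radius of the disc.
\<close>

lemma in_invariant_disc_step:
  assumes q: "q \<in> invariant_disc_region" and "c \<ge> 2" and w: "in_invariant_disc q w"
  shows "in_invariant_disc q ((1 - q ^ c) / (1 - q) - q ^ (c - 1) / w)"
proof -
  define r where "r = norm q"
  define \<eta> where "\<eta> = (1 - r\<^sup>2) / 2"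
  define z where "z = (1 - q) * w"
  obtain m where c: "c = m + 2"
    using \<open>c \<ge> 2\<close> by (metis le_add_diff_inverse2)
  have r: "0 \<le> r" "r < 1" and \<eta>2: "r * (norm (1 - q))\<^sup>2 \<le> \<eta>\<^sup>2"
    using q by (simp_all add: invariant_disc_region_def r_def \<eta>_def power_divide)
  have "q \<noteq> 1"
    using r by (auto simp: r_def)
  have "r\<^sup>2 < 1"
    using r by (simp add: abs_square_less_1)
  then have "\<eta> > 0"
    by (simp add: \<eta>_def)
  have "w \<noteq> 0" and z: "\<eta> \<le> norm z"
    using in_invariant_disc_bounds[OF _ w] r by (simp_all add: r_def \<eta>_def z_def)
  have "(1 - q) * ((1 - q ^ c) / (1 - q) - q ^ (c - 1) / w) - 1
      = - (q ^ m * (q\<^sup>2 + q * (1 - q)\<^sup>2 / z))"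
    using \<open>q \<noteq> 1\<close> \<open>w \<noteq> 0\<close> by (simp add: c z_def field_simps power2_eq_square)
  then have "norm ((1 - q) * ((1 - q ^ c) / (1 - q) - q ^ (c - 1) / w) - 1)
      = r ^ m * norm (q\<^sup>2 + q * (1 - q)\<^sup>2 / z)"
    by (simp add: norm_mult norm_power r_def)
  also have "\<dots> \<le> 1 * norm (q\<^sup>2 + q * (1 - q)\<^sup>2 / z)"
    using r by (intro mult_right_mono power_le_one) auto
  also have "\<dots> \<le> r\<^sup>2 + r * (norm (1 - q))\<^sup>2 / norm z"
    using norm_triangle_ineq[of "q\<^sup>2" "q * (1 - q)\<^sup>2 / z"]
    by (simp add: norm_mult norm_power norm_divide r_def)
  also have "r * (norm (1 - q))\<^sup>2 / norm z \<le> \<eta>\<^sup>2 / \<eta>"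
    using \<eta>2 z \<open>\<eta> > 0\<close> r by (intro frac_le) auto
  also have "r\<^sup>2 + \<eta>\<^sup>2 / \<eta> = (1 + r\<^sup>2) / 2"
    using \<open>\<eta> > 0\<close> by (simp add: power2_eq_square) (simp add: \<eta>_def power2_eq_square field_simps)
  finally show ?thesis
    by (simp add: in_invariant_disc_def r_def)
qed

lemma q_cf_value_in_disc:
  assumes "q \<in> invariant_disc_region" "cs \<noteq> []" "\<forall>c\<in>set cs. c \<ge> 2"
  shows "in_invariant_disc q (q_cf_value cs q)"
  using assms(2,3)
proof (induction cs rule: q_cf.induct)
  case (2 c)
  then show ?case
    using assms(1) q_int_in_invariant_disc by (simp add: invariant_disc_region_def)
next
  case (3 c d cs)
  then show ?case
    using in_invariant_disc_step[OF assms(1), of c "q_cf_value (d # cs) q"] by simp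
qed simp

lemma q_cf_value_holomorphic:
  assumes "\<forall>c\<in>set cs. c \<ge> 2"
  shows "q_cf_value cs holomorphic_on invariant_disc_region"
  using assms
proof (induction cs rule: q_cf.induct)
  case 1
  then show ?case by simp
next
  case (2 c)
  then show ?case
    by (auto intro!: holomorphic_intros simp: invariant_disc_region_def)
next
  case (3 c d cs)
  have "q_cf_value (d # cs) q \<noteq> 0" if "q \<in> invariant_disc_region" for q
    using in_invariant_disc_bounds(3)[OF _ q_cf_value_in_disc[OF that, of "d # cs"]] that 3
    by (auto simp: invariant_disc_region_def)
  moreover have "1 - q \<noteq> 0" if "q \<in> invariant_disc_region" for q
    using that by (auto simp: invariant_disc_region_def)
  moreover have "q_cf_value (d # cs) holomorphic_on invariant_disc_region"
    using 3 by auto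
  ultimately show ?case
    by (auto intro!: holomorphic_intros)
qed

lemma in_invariant_disc_closed:
  assumes "\<And>n. in_invariant_disc q (f n)" "f \<longlonglongrightarrow> w"
  shows "in_invariant_disc q w"
proof -
  have "(\<lambda>n. norm ((1 - q) * f n - 1)) \<longlonglongrightarrow> norm ((1 - q) * w - 1)"
    using assms(2) by (intro tendsto_intros)
  then show ?thesis
    unfolding in_invariant_disc_def
    by (rule LIMSEQ_le_const2) (use assms(1) in \<open>auto simp: in_invariant_disc_def\<close>)
qed


section \<open>The limit function\<close>

text \<open>
  Only a subsequence of the convergents is known to converge, but any such limit has the Taylor
  series \<open>[x]\<^bsub>q\<^esub>\<close>, because the Taylor coefficients of the convergents stabilise.
\<close>

lemma q_real_has_holomorphic_extension:
  assumes "x \<ge> 1"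
  obtains g where "g holomorphic_on invariant_disc_region"
    "\<And>q. q \<in> invariant_disc_region \<Longrightarrow> g q \<noteq> 0"
    "g has_fps_expansion complex_fps (q_real x)"
proof -
  let ?D = invariant_disc_region
  define c where "c = neg_cf_expansion x"
  \<comment> \<open>The empty convergent is \<open>0\<close>, which lies outside the discs, so the sequence starts at length \<open>1\<close>.\<close>
  define f where "f = (\<lambda>N. q_cf_value (map c [0..<Suc N]))"
  have c2: "\<forall>d\<in>set (map c [0..<N]). d \<ge> 2" for N
    using is_neg_cf_expansion_neg_cf_expansion[OF assms] by (simp add: c_def is_neg_cf_expansion_def)
  have holo: "f N holomorphic_on ?D" for N
    unfolding f_def by (rule q_cf_value_holomorphic[OF c2])
  have disc: "in_invariant_disc q (f N q)" if "q \<in> ?D" for q N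
    unfolding f_def by (rule q_cf_value_in_disc[OF that _ c2]) simp
  have bounded: "\<exists>B. \<forall>h\<in>range f. \<forall>q\<in>K. norm (h q) \<le> B" if K: "compact K" "K \<subseteq> ?D" for K
  proof -
    have ne: "norm (1 - q) \<noteq> 0" if "q \<in> K" for q
      using that K(2) by (auto simp: invariant_disc_region_def)
    have "compact ((\<lambda>q. 2 / norm (1 - q)) ` K)"
      using K(1) ne by (intro compact_continuous_image continuous_intros) auto
    then obtain B where B: "\<And>q. q \<in> K \<Longrightarrow> norm (2 / norm (1 - q)) \<le> B"
      by (meson bounded_iff compact_imp_bounded imageI)
    have "norm (f N q) \<le> B" if "q \<in> K" for N q
    proof -
      have "norm ((1 - q) * f N q) \<le> 2"
        using in_invariant_disc_bounds(2)[OF _ disc[of q N]] that K(2)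
        by (auto simp: invariant_disc_region_def)
      then have "norm (f N q) * norm (1 - q) \<le> 2"
        by (simp only: norm_mult mult.commute)
      then have "norm (f N q) \<le> 2 / norm (1 - q)"
        using ne[OF that] by (subst pos_le_divide_eq) auto
      also have "\<dots> \<le> B"
        using B[OF that] by simp
      finally show ?thesis .
    qed
    then show ?thesis by blast
  qed
  obtain g s where g: "g holomorphic_on ?D" and s: "strict_mono (s :: nat \<Rightarrow> nat)"
    and lim: "\<And>q. q \<in> ?D \<Longrightarrow> (\<lambda>n. f (s n) q) \<longlonglongrightarrow> g q"
    and ulim: "\<And>K. compact K \<Longrightarrow> K \<subseteq> ?D \<Longrightarrow> uniform_limit K (f \<circ> s) g sequentially"
  proof (rule Montel[OF open_invariant_disc_region, of "range f" f])
    show "h holomorphic_on ?D" if "h \<in> range f" for h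
      using that holo by blast
  qed (use bounded in auto)
  have nonzero: "g q \<noteq> 0" if "q \<in> ?D" for q
    using in_invariant_disc_bounds(3)[OF _ in_invariant_disc_closed[OF disc lim]] that
    by (auto simp: invariant_disc_region_def)
  have zero: "0 \<in> ?D"
    by (simp add: invariant_disc_region_def)
  then obtain e where e: "e > 0" "cball 0 e \<subseteq> ?D"
    using open_invariant_disc_region open_contains_cball by blast
  then have ball: "ball 0 e \<subseteq> ?D"
    using ball_subset_cball by blast
  have "g has_fps_expansion fps_expansion g 0"
    by (rule has_fps_expansion_fps_expansion[OF open_invariant_disc_region zero g])
  moreover have "fps_expansion g 0 = complex_fps (q_real x)"
  proof (rule uniform_limit_imp_fps_expansion_eq[where A = "ball 0 e" and f' = "f \<circ> s"])
    have "strict_mono (\<lambda>n. Suc (s n))"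
      using s by (simp add: strict_mono_def)
    then show "(\<lambda>n. q_trunc x (Suc (s n))) \<longlonglongrightarrow> complex_fps (q_real x)"
      using LIMSEQ_subseq_LIMSEQ[OF q_trunc_tendsto[OF assms]] by (simp add: o_def)
    show "uniform_limit (ball 0 e) (\<lambda>n. (f \<circ> s) n) g sequentially"
      using uniform_limit_on_subset[OF ulim[OF compact_cball e(2)] ball_subset_cball] .
    show "\<forall>\<^sub>F n in sequentially. (f \<circ> s) n has_fps_expansion q_trunc x (Suc (s n))"
      using q_cf_value_has_fps_expansion[OF c2]
      by (intro always_eventually) (simp add: f_def q_trunc_def c_def del: upt_Suc)
    show "\<forall>\<^sub>F n in sequentially. (f \<circ> s) n holomorphic_on ball 0 e"
      using holomorphic_on_subset[OF holo ball] by (intro always_eventually) simp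
  qed (use e calculation in auto)
  ultimately show ?thesis
    using that g nonzero by simp
qed

theorem theorem1p1:
  fixes x :: real
  assumes "x \<ge> 1"
  shows "(\<forall>q :: complex. norm q < 3 - 2 * sqrt 2 \<longrightarrow>
            summable (\<lambda>n. of_int (fps_nth (q_real x) n) * q ^ n)) \<and>
         (\<exists>g. g holomorphic_on q_region \<and>
              (\<forall>q\<in>q_region. g q \<noteq> 0) \<and>
              (\<forall>q :: complex. norm q < 3 - 2 * sqrt 2 \<longrightarrow>
                 g q = (\<Sum>n. of_int (fps_nth (q_real x) n) * q ^ n)))"
proof -
  obtain g where g: "g holomorphic_on invariant_disc_region"
    and nonzero: "\<And>q. q \<in> invariant_disc_region \<Longrightarrow> g q \<noteq> 0"
    and expansion: "g has_fps_expansion complex_fps (q_real x)"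
    using q_real_has_holomorphic_extension[OF assms] by blast
  have "g holomorphic_on eball 0 (ereal (3 - 2 * sqrt 2))"
    using holomorphic_on_subset[OF g ball_subset_invariant_disc_region] by simp
  then have sums: "(\<lambda>n. of_int (fps_nth (q_real x) n) * q ^ n) sums g q"
    if "norm q < 3 - 2 * sqrt 2" for q
    using has_fps_expansion_imp_sums_complex[OF expansion, of "ereal (3 - 2 * sqrt 2)" q] that
    by simp
  have "g holomorphic_on q_region"
    using g q_region_subset_invariant_disc_region by (rule holomorphic_on_subset)
  moreover have "\<forall>q\<in>q_region. g q \<noteq> 0"
    using nonzero q_region_subset_invariant_disc_region by blast
  ultimately show ?thesis
    using sums by (auto simp: sums_iff)
qed

end
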